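(* The edge-forcing number of the butterfly network $BF(3)$ is $8$: $\zeta_e(BF(3))=8$.
   Context: The $r$-dimensional butterfly network $BF(r)$ has vertex set $\{[w;i] : w\in\{0,1\}^r,\ 0\le i\le r\}$, and $[w;i]$ is adjacent to $[w';j]$ iff $j=i+1$ and either $w=w'$ or $w$ and $w'$ differ precisely in the $j$-th bit. Forcing (closure) rule: for a graph $G=(V,E)$ and $T\subseteq V$, the closure $C_G(T)$ starts as $T$ and, as long as some vertex of $C_G(T)$ has exactly one neighbor not in $C_G(T)$, that neighbor is added. Edge-forcing set: a set $K$ of pairwise independent edges of $G$ such that, with $T$ the set of endpoints of edges of $K$, $C_G(T)=V$. $\zeta_e(G)$ is the minimum cardinality of an edge-forcing set of $G$. *)

theory Defs
  imports Main
begin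

text \<open>A graph is a pair of its vertex set and its set of edges, an edge being an unordered
  pair \<open>{u, v}\<close> of distinct vertices.\<close>

type_synonym 'a graph = "'a set \<times> 'a set set"

definition neighbors :: "'a graph \<Rightarrow> 'a \<Rightarrow> 'a set" where
  "neighbors G u = {v \<in> fst G. {u, v} \<in> snd G}"

text \<open>One application of the forcing rule: some vertex \<open>u\<close> of \<open>C\<close> has exactly one neighbor
  \<open>v\<close> outside \<open>C\<close>, and \<open>v\<close> is added.\<close>

definition forcing_step :: "'a graph \<Rightarrow> 'a set \<Rightarrow> 'a set \<Rightarrow> bool" where
  "forcing_step G C D \<longleftrightarrow> (\<exists>u\<in>C. \<exists>v. neighbors G u - C = {v} \<and> D = insert v C)"

text \<open>The set generated by the forcing rule. The lemma \<open>forcing_closure_eq\<close> below shows that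
  it is the outcome of every terminating run of forcing steps, whatever the order in which the
  vertices are added.\<close>

inductive_set forcing_closure :: "'a graph \<Rightarrow> 'a set \<Rightarrow> 'a set" for G T where
  base: "v \<in> T \<Longrightarrow> v \<in> forcing_closure G T"
| force: "\<lbrakk>u \<in> forcing_closure G T; v \<in> neighbors G u;
          \<And>w. w \<in> neighbors G u \<Longrightarrow> w \<noteq> v \<Longrightarrow> w \<in> forcing_closure G T\<rbrakk>
         \<Longrightarrow> v \<in> forcing_closure G T"

lemma forcing_steps_subset_closure:
  assumes "(forcing_step G)\<^sup>*\<^sup>* T C"
  shows "T \<subseteq> C \<and> C \<subseteq> forcing_closure G T"
  using assms
proof (induction rule: rtranclp_induct)
  case base
  then show ?case by (auto intro: forcing_closure.base)
next
  case (step C D)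
  then obtain u v where uv: "u \<in> C" "neighbors G u - C = {v}" "D = insert v C"
    unfolding forcing_step_def by blast
  have "v \<in> forcing_closure G T"
    by (rule forcing_closure.force[of u]) (use uv step.IH in blast)+
  then show ?case using uv step.IH by blast
qed

lemma forcing_closure_eq:
  assumes "(forcing_step G)\<^sup>*\<^sup>* T C" and "\<nexists>D. forcing_step G C D"
  shows "C = forcing_closure G T"
proof
  show "C \<subseteq> forcing_closure G T"
    using forcing_steps_subset_closure[OF assms(1)] by blast
  show "forcing_closure G T \<subseteq> C"
  proof
    fix x assume "x \<in> forcing_closure G T"
    then show "x \<in> C"
    proof induction
      case (base v)
      then show ?case using forcing_steps_subset_closure[OF assms(1)] by blast
    next
      case (force u v)
      show ?case
      proof (rule ccontr)
        assume "v \<notin> C"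
        then have "neighbors G u - C = {v}" using force by blast
        then show False using assms(2) force unfolding forcing_step_def by blast
      qed
    qed
  qed
qed

definition edge_forcing_set :: "'a graph \<Rightarrow> 'a set set \<Rightarrow> bool" where
  "edge_forcing_set G K \<longleftrightarrow>
     K \<subseteq> snd G \<and> pairwise disjnt K \<and> forcing_closure G (\<Union>K) = fst G"

text \<open>Intended for finite graphs, where every edge set has a meaningful \<open>card\<close>.\<close>

definition edge_forcing_number :: "'a graph \<Rightarrow> nat" where
  "edge_forcing_number G = (LEAST k. \<exists>K. edge_forcing_set G K \<and> card K = k)"

text \<open>The vertex \<open>[w; i]\<close> is the pair \<open>(w, i)\<close>. Bits are numbered \<open>1, \<dots>, r\<close>, list positions
  \<open>0, \<dots>, r - 1\<close>; so the bit with number \<open>i + 1\<close> sits at position \<open>i\<close>.\<close>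

definition butterfly_vertices :: "nat \<Rightarrow> (bool list \<times> nat) set" where
  "butterfly_vertices r = {(w, i). length w = r \<and> i \<le> r}"

definition differ_precisely_at :: "nat \<Rightarrow> 'a list \<Rightarrow> 'a list \<Rightarrow> bool" where
  "differ_precisely_at p w w' \<longleftrightarrow>
     length w = length w' \<and> (\<forall>q<length w. w ! q \<noteq> w' ! q \<longleftrightarrow> q = p)"

definition butterfly_adj :: "bool list \<times> nat \<Rightarrow> bool list \<times> nat \<Rightarrow> bool" where
  "butterfly_adj = (\<lambda>(w, i) (w', j). j = i + 1 \<and> (w = w' \<or> differ_precisely_at (j - 1) w w'))"

definition BF :: "nat \<Rightarrow> (bool list \<times> nat) graph" where
  "BF r = (butterfly_vertices r,
           {{x, y} | x y. x \<in> butterfly_vertices r \<and> y \<in> butterfly_vertices r \<and>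
                          butterfly_adj x y})"

end

theory Submission
  imports Defs
begin

text \<open>Two vertices with the same neighbors can never be forced unless one of them is there from
  the start. In \<open>BF r\<close> the vertices at level \<open>0\<close> fall into \<open>2 ^ (r - 1)\<close> pairs of such twins, and
  so do those at level \<open>r\<close>; for \<open>r \<ge> 2\<close> no edge meets two of these pairs, so at least
  \<open>2 ^ r\<close> edges are needed.

  Conversely, for \<open>r = 3\<close>, the \<open>4\<close>-cycles between levels \<open>0\<close> and \<open>1\<close> and those between levels
  \<open>2\<close> and \<open>3\<close> partition the vertices; choose one edge in each. The chosen endpoint at an outer
  level forces the rest of the inner levels \<open>1\<close> and \<open>2\<close>, whose vertices then have at most one
  missing neighbor each and force the outer levels.\<close>

text \<open>A vertex that forces one twin also has the other as a neighbor, which must then be in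
  the closure already; so neither can be the first to enter.\<close>

lemma forcing_closure_meets_twins:
  assumes "\<And>x. u \<in> neighbors G x \<longleftrightarrow> v \<in> neighbors G x" and "u \<noteq> v"
    and "u \<in> forcing_closure G T"
  shows "u \<in> T \<or> v \<in> T"
proof (rule ccontr)
  assume T: "\<not> (u \<in> T \<or> v \<in> T)"
  have "x \<noteq> u \<and> x \<noteq> v" if "x \<in> forcing_closure G T" for x
    using that
  proof induction
    case (base x)
    then show ?case using T by blast
  next
    case (force x y)
    then show ?case using assms(1,2) by blast
  qed
  then show False using assms(3) by blast
qed

section \<open>Adjacency and edges in the butterfly network\<close>

lemma eq_or_differ_precisely_at_iff:
  fixes w :: "bool list"
  assumes "p < length w"
  shows "w = w' \<or> differ_precisely_at p w w' \<longleftrightarrow> w' = w \<or> w' = w[p := \<not> w ! p]"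
proof -
  have "differ_precisely_at p w w' \<longleftrightarrow> w' = w[p := \<not> w ! p]"
    using assms unfolding differ_precisely_at_def
    by (auto simp: list_eq_iff_nth_eq nth_list_update)
  then show ?thesis by auto
qed

lemma butterfly_adj_iff:
  assumes "i < length w"
  shows "butterfly_adj (w, i) (w', j) \<longleftrightarrow> j = Suc i \<and> (w' = w \<or> w' = w[i := \<not> w ! i])"
proof -
  have "butterfly_adj (w, i) (w', j) \<longleftrightarrow> j = Suc i \<and> (w = w' \<or> differ_precisely_at i w w')"
    by (auto simp: butterfly_adj_def)
  then show ?thesis unfolding eq_or_differ_precisely_at_iff[OF assms] .
qed

lemma butterfly_adj_lengthD:
  "butterfly_adj (w, i) (w', j) \<Longrightarrow> length w' = length w \<and> j = Suc i"
  by (auto simp: butterfly_adj_def differ_precisely_at_def)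

lemma in_neighbors_BF_iff:
  "y \<in> neighbors (BF r) x \<longleftrightarrow> x \<in> butterfly_vertices r \<and> y \<in> butterfly_vertices r \<and>
     (butterfly_adj x y \<or> butterfly_adj y x)"
  unfolding neighbors_def BF_def by (auto simp: doubleton_eq_iff simp del: split_paired_Ex)

lemma finite_butterfly_vertices: "finite (butterfly_vertices r)"
proof -
  have "butterfly_vertices r = {w. set w \<subseteq> UNIV \<and> length w = r} \<times> {..r}"
    by (auto simp: butterfly_vertices_def)
  moreover have "finite {w :: bool list. set w \<subseteq> UNIV \<and> length w = r}"
    by (rule finite_lists_length_eq) simp
  ultimately show ?thesis by simp
qed

lemma finite_edges_BF: "finite (snd (BF r))"
  by (rule finite_subset[of _ "Pow (butterfly_vertices r)"])
    (auto simp: BF_def finite_butterfly_vertices)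

lemma edges_BF_I:
  "x \<in> butterfly_vertices r \<Longrightarrow> y \<in> butterfly_vertices r \<Longrightarrow> butterfly_adj x y
    \<Longrightarrow> {x, y} \<in> snd (BF r)"
  unfolding BF_def snd_conv by blast

lemma edges_BF_E:
  assumes "e \<in> snd (BF r)"
  obtains w w' i where "e = {(w, i), (w', Suc i)}" "length w = r" "length w' = r" "i < r"
    "butterfly_adj (w, i) (w', Suc i)"
proof -
  obtain w i w' j where "e = {(w, i), (w', j)}" "(w, i) \<in> butterfly_vertices r"
    "(w', j) \<in> butterfly_vertices r" "butterfly_adj (w, i) (w', j)"
    using assms by (auto simp: BF_def)
  then show ?thesis
    using that butterfly_adj_lengthD[of w i w' j] by (auto simp: butterfly_vertices_def)
qed

section \<open>Twin vertices and the lower bound\<close>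

text \<open>Passing from level 0 to level 1 leaves the first bit free, so both vertices have the
  neighbors \<open>(False # u, 1)\<close> and \<open>(True # u, 1)\<close>.\<close>

lemma twins_level_0:
  assumes "length u = r"
  shows "(a # u, 0) \<in> neighbors (BF (Suc r)) x \<longleftrightarrow> (b # u, 0) \<in> neighbors (BF (Suc r)) x"
proof -
  obtain w i where "x = (w, i)" by (cases x)
  then show ?thesis
    using assms butterfly_adj_lengthD[of w i _ 0]
    by (cases a; cases b) (auto simp: in_neighbors_BF_iff butterfly_vertices_def butterfly_adj_iff)
qed

lemma butterfly_adj_last_bit:
  "butterfly_adj (w @ [c], length w) (u @ [d], Suc (length w)) \<longleftrightarrow> w = u"
  by (cases c; cases d) (auto simp: butterfly_adj_iff)

lemma twins_top_level:
  assumes "length u = r"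
  shows "(u @ [a], Suc r) \<in> neighbors (BF (Suc r)) x
    \<longleftrightarrow> (u @ [b], Suc r) \<in> neighbors (BF (Suc r)) x"
\<comment> \<open>Only vertices at level \<open>r\<close> can be adjacent to the top level. For
  these the bit at position \<open>r\<close>, the last one, is free, so adjacency depends on the
  prefix \<open>w\<close> alone.\<close>
proof (cases "\<exists>w c. x = (w @ [c], r)")
  case True
  then obtain w c where "x = (w @ [c], r)" by blast
  then have "(u @ [d], Suc r) \<in> neighbors (BF (Suc r)) x \<longleftrightarrow> w = u" for d
    using assms butterfly_adj_last_bit[of w c u d] butterfly_adj_lengthD[of "u @ [d]" "Suc r" _ r]
    by (auto simp: in_neighbors_BF_iff butterfly_vertices_def)
  then show ?thesis by blast
next
  case False
  have "(u @ [d], Suc r) \<notin> neighbors (BF (Suc r)) x" for d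
  proof
    assume "(u @ [d], Suc r) \<in> neighbors (BF (Suc r)) x"
    then have "snd x = r" "length (fst x) = Suc r"
      by (cases x; auto simp: in_neighbors_BF_iff butterfly_vertices_def
          dest: butterfly_adj_lengthD)+
    then have "x = (butlast (fst x) @ [last (fst x)], r)"
      by (metis append_butlast_last_id length_0_conv nat.distinct(1) prod.collapse)
    with False show False by blast
  qed
  then show ?thesis by blast
qed

text \<open>The Boolean tag selects level 0 or level \<open>r\<close>; a common index type lets one
  injection count both families. The word \<open>u\<close> is meant to have length
  \<open>r - 1\<close>.\<close>

fun twin_pair :: "nat \<Rightarrow> bool \<times> bool list \<Rightarrow> (bool list \<times> nat) set" where
  "twin_pair r (True, u) = {(False # u, 0), (True # u, 0)}"
| "twin_pair r (False, u) = {(u @ [False], r), (u @ [True], r)}"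

lemma edge_forcing_set_meets_twin_pair:
  assumes "edge_forcing_set (BF (Suc r)) K" and "length (snd p) = r"
  shows "\<exists>e\<in>K. e \<inter> twin_pair (Suc r) p \<noteq> {}"
proof -
  have closure: "forcing_closure (BF (Suc r)) (\<Union>K) = butterfly_vertices (Suc r)"
    using assms(1) by (simp add: edge_forcing_set_def BF_def)
  obtain t u where p: "p = (t, u)" by (cases p)
  have "(False # u, 0) \<in> \<Union>K \<or> (True # u, 0) \<in> \<Union>K"
    by (rule forcing_closure_meets_twins[where G = "BF (Suc r)"])
      (use assms p twins_level_0 closure in \<open>auto simp: butterfly_vertices_def\<close>)
  moreover have "(u @ [False], Suc r) \<in> \<Union>K \<or> (u @ [True], Suc r) \<in> \<Union>K"
    by (rule forcing_closure_meets_twins[where G = "BF (Suc r)"])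
      (use assms p twins_top_level closure in \<open>auto simp: butterfly_vertices_def\<close>)
  ultimately show ?thesis using p by (cases t) auto
qed

text \<open>An edge joins consecutive levels, so for \<open>2 \<le> r\<close> at most one endpoint
  lies at level 0 or \<open>r\<close>, and that endpoint determines its pair.\<close>

lemma edge_meets_one_twin_pair:
  assumes "e \<in> snd (BF r)" and "2 \<le> r"
    and "e \<inter> twin_pair r p \<noteq> {}" and "e \<inter> twin_pair r q \<noteq> {}"
  shows "p = q"
proof -
  obtain w w' i where "e = {(w, i), (w', Suc i)}" "i < r"
    using assms(1) by (rule edges_BF_E)
  moreover obtain s u t v where "p = (s, u)" "q = (t, v)" by (cases p; cases q)
  ultimately show ?thesis
    using assms(2-) by (cases s; cases t) auto
qed

lemma edge_forcing_set_BF_card_ge: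
  assumes "edge_forcing_set (BF r) K" and "2 \<le> r"
  shows "2 ^ r \<le> card K"
proof -
  obtain m where r: "r = Suc m" using assms(2) by (cases r) auto
  \<comment> \<open>The indices of all twin pairs, \<open>2 * 2 ^ m = 2 ^ r\<close> in
    number.\<close>
  define I where "I = (UNIV :: bool set) \<times> {u :: bool list. set u \<subseteq> UNIV \<and> length u = m}"
  have "\<forall>p\<in>I. \<exists>e\<in>K. e \<inter> twin_pair r p \<noteq> {}"
    using edge_forcing_set_meets_twin_pair[of m K] assms(1) r by (auto simp: I_def)
  then obtain g where g: "\<And>p. p \<in> I \<Longrightarrow> g p \<in> K \<and> g p \<inter> twin_pair r p \<noteq> {}"
    by metis
  have K: "K \<subseteq> snd (BF r)" using assms(1) by (simp add: edge_forcing_set_def)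
  have "inj_on g I"
    using g K edge_meets_one_twin_pair[OF _ assms(2)] by (metis inj_onI subsetD)
  moreover have "g ` I \<subseteq> K" using g by blast
  \<comment> \<open>\<open>K\<close> is finite, being a set of edges, so \<open>card K\<close> is
    not the default value 0 of an infinite set.\<close>
  ultimately have "card I \<le> card K"
    using K finite_edges_BF finite_subset card_inj_on_le by metis
  moreover have "card I = 2 ^ r"
    unfolding I_def card_cartesian_product
    using card_lists_length_eq[of "UNIV :: bool set" m] r by simp
  ultimately show ?thesis by simp
qed

section \<open>Neighborhoods in dimension 3, bit by bit\<close>

lemma butterfly_vertices_3_cases:
  assumes "x \<in> butterfly_vertices 3"
  obtains a b c where "x = ([a, b, c], 0)" | a b c where "x = ([a, b, c], 1)"
    | a b c where "x = ([a, b, c], 2)" | a b c where "x = ([a, b, c], 3)"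
proof -
  obtain w i where x: "x = (w, i)" "length w = 3" "i \<le> 3"
    using assms by (auto simp: butterfly_vertices_def)
  then obtain a b c where "w = [a, b, c]"
    by (auto simp: numeral_3_eq_3 length_Suc_conv)
  moreover have "i = 0 \<or> i = 1 \<or> i = 2 \<or> i = 3" using x(3) by linarith
  ultimately show ?thesis using that x(1) by metis
qed

lemma butterfly_adj_3_bits:
  "butterfly_adj ([a, b, c], i) ([a', b', c'], j) \<longleftrightarrow>
     j = Suc i \<and> (i = 0 \<or> a' = a) \<and> (i = 1 \<or> b' = b) \<and> (i = 2 \<or> c' = c)"
proof (cases "j = Suc i")
  case True
  then show ?thesis
    unfolding butterfly_adj_def differ_precisely_at_def
    by (cases "i = 0"; cases "i = 1"; cases "i = 2"; simp add: All_less_Suc2; blast)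
qed (simp add: butterfly_adj_def)

lemma neighbors_BF_3:
  "neighbors (BF 3) ([a, b, c], 0) = range (\<lambda>x. ([x, b, c], 1))"
  "neighbors (BF 3) ([a, b, c], 1) = range (\<lambda>x. ([x, b, c], 0))
    \<union> range (\<lambda>x. ([a, x, c], 2))"
  "neighbors (BF 3) ([a, b, c], 2) = range (\<lambda>x. ([a, x, c], 1))
    \<union> range (\<lambda>x. ([a, b, x], 3))"
  "neighbors (BF 3) ([a, b, c], 3) = range (\<lambda>x. ([a, b, x], 2))"
proof -
  \<comment> \<open>With words written out as three bits and the level one of four numbers, each
    neighborhood becomes a finite check by \<open>butterfly_adj_3_bits\<close>.\<close>
  have eqI: "neighbors (BF 3) x = S"
    if "S \<subseteq> butterfly_vertices 3" and "x \<in> butterfly_vertices 3"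
      and adj: "\<And>a b c j. j \<in> {0, 1, 2, 3} \<Longrightarrow>
        butterfly_adj x ([a, b, c], j) \<or> butterfly_adj ([a, b, c], j) x \<longleftrightarrow> ([a, b, c], j) \<in> S"
    for x S
  proof -
    have "butterfly_adj x y \<or> butterfly_adj y x \<longleftrightarrow> y \<in> S" if "y \<in> butterfly_vertices 3" for y
      using that
      by (cases rule: butterfly_vertices_3_cases) (simp_all only: adj insert_iff simp_thms)
    then have "y \<in> neighbors (BF 3) x \<longleftrightarrow> y \<in> S" for y
      unfolding in_neighbors_BF_iff using that(1,2) by blast
    then show ?thesis by blast
  qed
  show "neighbors (BF 3) ([a, b, c], 0) = range (\<lambda>x. ([x, b, c], 1))"
    by (rule eqI, force simp: butterfly_vertices_def, simp add: butterfly_vertices_def,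
        elim insertE emptyE; simp add: butterfly_adj_3_bits image_iff; blast)
  show "neighbors (BF 3) ([a, b, c], 1) = range (\<lambda>x. ([x, b, c], 0))
    \<union> range (\<lambda>x. ([a, x, c], 2))"
    by (rule eqI, force simp: butterfly_vertices_def, simp add: butterfly_vertices_def,
        elim insertE emptyE; simp add: butterfly_adj_3_bits image_iff; blast)
  show "neighbors (BF 3) ([a, b, c], 2) = range (\<lambda>x. ([a, x, c], 1))
    \<union> range (\<lambda>x. ([a, b, x], 3))"
    by (rule eqI, force simp: butterfly_vertices_def, simp add: butterfly_vertices_def,
        elim insertE emptyE; simp add: butterfly_adj_3_bits image_iff; blast)
  show "neighbors (BF 3) ([a, b, c], 3) = range (\<lambda>x. ([a, b, x], 2))"
    by (rule eqI, force simp: butterfly_vertices_def, simp add: butterfly_vertices_def,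
        elim insertE emptyE; simp add: butterfly_adj_3_bits image_iff; blast)
qed

section \<open>Eight edges that force the whole network\<close>

text \<open>The tag selects the lower or the upper family of 4-cycles; \<open>a\<close> and
  \<open>b\<close> are the bits constant on the cycle. The chosen edge has the varying bit
  \<open>False\<close> at both ends.\<close>

fun cycle_edge :: "bool \<times> bool \<times> bool \<Rightarrow> (bool list \<times> nat) set" where
  "cycle_edge (True, a, b) = {([False, a, b], 0), ([False, a, b], 1)}"
| "cycle_edge (False, a, b) = {([a, b, False], 2), ([a, b, False], 3)}"

lemma cycle_edge_disjoint:
  "p \<noteq> q \<Longrightarrow> cycle_edge p \<inter> cycle_edge q = {}"
  by (cases p rule: cycle_edge.cases; cases q rule: cycle_edge.cases; simp)

lemma forcing_closure_subset:
  assumes "T \<subseteq> fst G"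
  shows "forcing_closure G T \<subseteq> fst G"
proof
  fix x assume "x \<in> forcing_closure G T"
  then show "x \<in> fst G"
    by cases (use assms in \<open>blast, simp add: neighbors_def\<close>)
qed

lemma edge_forcing_set_cycle_edges: "edge_forcing_set (BF 3) (range cycle_edge)"
proof -
  let ?C = "forcing_closure (BF 3) (\<Union>(range cycle_edge))"
  have edges: "cycle_edge p \<in> snd (BF 3)" for p
    by (cases p rule: cycle_edge.cases)
      (simp_all add: edges_BF_I butterfly_vertices_def butterfly_adj_def)
  have base: "x \<in> ?C" if "x \<in> cycle_edge p" for x p
    by (rule forcing_closure.base) (use that in blast)
  have 0: "([False, a, b], 0) \<in> ?C" and 1: "([False, a, b], 1) \<in> ?C" for a b
    by (rule base[of _ "(True, a, b)"], simp)+
  have 2: "([a, b, False], 2) \<in> ?C" and 3: "([a, b, False], 3) \<in> ?C" for a b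
    by (rule base[of _ "(False, a, b)"], simp)+
  \<comment> \<open>Each fact is named after its level; from here on the case of varying bit
    \<open>False\<close> is extended to all words, inner levels first.\<close>
  have 1: "([a, b, c], 1) \<in> ?C" for a b c
  proof (cases a)
    case True
    show ?thesis
      by (rule forcing_closure.force[OF 0[of b c]])
        (use True 1[of b c] in \<open>auto simp: neighbors_BF_3[simplified] UNIV_bool\<close>)
  qed (use 1 in simp)
  have 2: "([a, b, c], 2) \<in> ?C" for a b c
  proof (cases c)
    case True
    show ?thesis
      by (rule forcing_closure.force[OF 3[of a b]])
        (use True 2[of a b] in \<open>auto simp: neighbors_BF_3[simplified] UNIV_bool\<close>)
  qed (use 2 in simp)
  \<comment> \<open>Level 2 is complete by now, so a level 1 vertex misses at most its level 0
    neighbor with first bit \<open>True\<close>.\<close>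
  have 0: "([a, b, c], 0) \<in> ?C" for a b c
  proof (cases a)
    case True
    show ?thesis
      by (rule forcing_closure.force[OF 1[of a b c]])
        (use True 0[of b c] 2 in \<open>auto simp: neighbors_BF_3[simplified] UNIV_bool\<close>)
  qed (use 0 in simp)
  have 3: "([a, b, c], 3) \<in> ?C" for a b c
  proof (cases c)
    case True
    show ?thesis
      by (rule forcing_closure.force[OF 2[of a b c]])
        (use True 3[of a b] 1 in \<open>auto simp: neighbors_BF_3[simplified] UNIV_bool\<close>)
  qed (use 3 in simp)
  have "fst (BF 3) \<subseteq> ?C"
  proof
    fix x assume "x \<in> fst (BF 3)"
    then have "x \<in> butterfly_vertices 3" by (simp add: BF_def)
    then show "x \<in> ?C"
      by (cases rule: butterfly_vertices_3_cases) (use 0 1 2 3 in simp_all)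
  qed
  moreover have "?C \<subseteq> fst (BF 3)"
  proof (rule forcing_closure_subset)
    have "e \<subseteq> fst (BF 3)" if "e \<in> snd (BF 3)" for e
      using that by (auto simp: BF_def)
    then show "\<Union>(range cycle_edge) \<subseteq> fst (BF 3)" using edges by blast
  qed
  moreover have "pairwise disjnt (range cycle_edge)"
    unfolding pairwise_def disjnt_def using cycle_edge_disjoint by (metis imageE)
  ultimately show ?thesis
    using edges unfolding edge_forcing_set_def by blast
qed

lemma card_range_cycle_edge: "card (range cycle_edge) = 8"
proof -
  \<comment> \<open>Two equal disjoint sets are empty, so nonemptiness turns
    \<open>cycle_edge_disjoint\<close> into injectivity.\<close>
  have "cycle_edge p \<noteq> {}" for p
    by (cases p rule: cycle_edge.cases) auto
  then have "inj cycle_edge"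
    using cycle_edge_disjoint by (metis Int_absorb injI)
  then have "card (range cycle_edge) = card (UNIV :: (bool \<times> bool \<times> bool) set)"
    by (rule card_image)
  then show ?thesis
    by (simp only: UNIV_Times_UNIV[symmetric] card_cartesian_product card_UNIV_bool)
qed

theorem theorem4p3:
  shows "edge_forcing_number (BF 3) = 8"
  unfolding edge_forcing_number_def
proof (rule Least_equality)
  show "\<exists>K. edge_forcing_set (BF 3) K \<and> card K = 8"
    using edge_forcing_set_cycle_edges card_range_cycle_edge by blast
  show "8 \<le> k" if "\<exists>K. edge_forcing_set (BF 3) K \<and> card K = k" for k
    using that edge_forcing_set_BF_card_ge[of 3] by auto
qed

end
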